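(* Consider any algorithm that selects a sequence of pairs $(x_t,y_t)\in\Delta_{d_1}\times\Delta_{d_2}$, $t=1,2,\dots$, given the past payoff matrices $A_1,\dots,A_{t-1}$. Consider the following three objectives: $$\left|\sum_{t=1}^T x_t^\top A_t y_t-\min_{x\in\Delta_{d_1}}\max_{y\in\Delta_{d_2}}\sum_{t=1}^T x^\top A_t y\right|=o(T),$$ $$\sum_{t=1}^T x_t^\top A_t y_t-\min_{x\in\Delta_{d_1}}\sum_{t=1}^T x^\top A_t y_t=o(T),$$ $$\max_{y\in\Delta_{d_2}}\sum_{t=1}^T x_t^\top A_t y-\sum_{t=1}^T x_t^\top A_t y_t=o(T).$$ Then there exists an (adversarially chosen) sequence $A_1,A_2,\ldots$ of matrices in $[-1,1]^{d_1\times d_2}$ such that not all three of these objectives are true.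
   Context: Two players play a repeated zero-sum game over $T$ rounds; player 1 has $d_1$ actions and player 2 has $d_2$ actions. $\Delta_d=\{v\in\mathbb{R}^d:\ v\ge 0,\ \|v\|_1=1\}$ is the unit simplex, so $x_t\in\Delta_{d_1}$ and $y_t\in\Delta_{d_2}$ are mixed strategies of players 1 and 2. In each round $t$ the strategies $x_t,y_t$ are chosen before the payoff matrix $A_t\in\mathbb{R}^{d_1\times d_2}$ is revealed; then $x_t^\top A_t y_t$ is the loss of player 1 and the gain of player 2. The sequence of payoff matrices may be arbitrary. The notation $o(T)$ refers to $T\to\infty$.
   Formalization: The formal statement assumes that both players have at least two actions (d_1 ≥ 2 and d_2 ≥ 2); if either has only one action the claim fails, e.g. for d_1 = d_2 = 1 all three quantities are identically zero. *)

theory Defs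
  imports "HOL-Analysis.Analysis" "HOL-Library.Landau_Symbols"
begin

definition prob_simplex :: "(real ^ 'd::finite) set" where
  "prob_simplex = {v. (\<forall>i. 0 \<le> v $ i) \<and> (\<Sum>i\<in>UNIV. \<bar>v $ i\<bar>) = 1}"

definition payoff :: "real ^ 'm::finite \<Rightarrow> real ^ 'n::finite ^ 'm \<Rightarrow> real ^ 'n \<Rightarrow> real" where
  "payoff x M y = x \<bullet> (M *v y)"

(* A deterministic algorithm sends the list of all past payoff matrices, oldest first, to the
   pair of mixed strategies for the next round; the length of the list determines the round. *)
type_synonym ('m, 'n) algorithm = "(real ^ 'n ^ 'm) list \<Rightarrow> (real ^ 'm) \<times> (real ^ 'n)"

(* Rounds are numbered from 1, so A 0 is never used: round t sees only A 1, ..., A (t - 1). *)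
definition strategy1 ::
  "('m::finite, 'n::finite) algorithm \<Rightarrow> (nat \<Rightarrow> real ^ 'n ^ 'm) \<Rightarrow> nat \<Rightarrow> real ^ 'm" where
  "strategy1 alg A t = fst (alg (map A [1..<t]))"

definition strategy2 ::
  "('m::finite, 'n::finite) algorithm \<Rightarrow> (nat \<Rightarrow> real ^ 'n ^ 'm) \<Rightarrow> nat \<Rightarrow> real ^ 'n" where
  "strategy2 alg A t = snd (alg (map A [1..<t]))"

(* The lemmas below show that the infima and suprema over the simplex used to express the
   minima and maxima of cumulative payoffs are attained. *)

lemma compact_prob_simplex: "compact (prob_simplex :: (real ^ 'd::finite) set)"
proof -
  have "closed (prob_simplex :: (real ^ 'd) set)"
    unfolding prob_simplex_def
    by (intro closed_Collect_conj closed_Collect_all closed_Collect_le closed_Collect_eq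
        continuous_intros)
  moreover have "bounded (prob_simplex :: (real ^ 'd) set)"
    unfolding bounded_iff prob_simplex_def
    by (metis (mono_tags, lifting) mem_Collect_eq norm_le_l1_cart)
  ultimately show ?thesis
    by (simp add: compact_eq_bounded_closed)
qed

lemma prob_simplex_nonempty: "(prob_simplex :: (real ^ 'd::finite) set) \<noteq> {}"
proof -
  obtain k :: 'd where True by simp
  have "(axis k 1 :: real ^ 'd) \<in> prob_simplex"
    by (simp add: prob_simplex_def axis_def if_distrib cong: if_cong)
  then show ?thesis by blast
qed

lemma sum_payoff_left: "(\<Sum>t\<in>S. payoff x (M t) (y t)) = x \<bullet> (\<Sum>t\<in>S. M t *v y t)"
  by (simp add: payoff_def inner_sum_right)

lemma sum_payoff_right: "(\<Sum>t\<in>S. payoff (x t) (M t) y) = (\<Sum>t\<in>S. x t v* M t) \<bullet> y"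
  by (simp add: payoff_def inner_sum_left dot_matrix_vector_mul dot_lmul_matrix)

lemma min_payoff_attained:
  "\<exists>x\<in>prob_simplex. (\<Sum>t\<in>S. payoff x (M t) (y t))
     = (INF x\<in>prob_simplex. \<Sum>t\<in>S. payoff x (M t) (y t))"
proof -
  have "continuous_on prob_simplex (\<lambda>x. \<Sum>t\<in>S. payoff x (M t) (y t))"
    unfolding payoff_def by (intro continuous_intros)
  then obtain x where x: "x \<in> prob_simplex"
    "\<And>z. z \<in> prob_simplex \<Longrightarrow> (\<Sum>t\<in>S. payoff x (M t) (y t)) \<le> (\<Sum>t\<in>S. payoff z (M t) (y t))"
    using continuous_attains_inf[OF compact_prob_simplex prob_simplex_nonempty] by blast
  then show ?thesis
    by (intro bexI[of _ x] cInf_eq_minimum[symmetric]) auto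
qed

lemma max_payoff_attained:
  "\<exists>y\<in>prob_simplex. (\<Sum>t\<in>S. payoff (x t) (M t) y)
     = (SUP y\<in>prob_simplex. \<Sum>t\<in>S. payoff (x t) (M t) y)"
proof -
  have "continuous_on prob_simplex (\<lambda>y. \<Sum>t\<in>S. payoff (x t) (M t) y)"
    unfolding sum_payoff_right by (intro continuous_intros)
  then obtain y where y: "y \<in> prob_simplex"
    "\<And>z. z \<in> prob_simplex \<Longrightarrow> (\<Sum>t\<in>S. payoff (x t) (M t) z) \<le> (\<Sum>t\<in>S. payoff (x t) (M t) y)"
    using continuous_attains_sup[OF compact_prob_simplex prob_simplex_nonempty] by blast
  then show ?thesis
    by (intro bexI[of _ y] cSup_eq_maximum[symmetric]) auto
qed

lemma minmax_payoff_attained: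
  "\<exists>x\<in>prob_simplex. (SUP y\<in>prob_simplex. \<Sum>t\<in>S. payoff x (M t) y)
     = (INF x\<in>prob_simplex. SUP y\<in>prob_simplex. \<Sum>t\<in>S. payoff x (M t) y)"
proof -
  define P where "P x y = (\<Sum>t\<in>S. payoff x (M t) y)" for x y
  define F where "F x = (SUP y\<in>prob_simplex. P x y)" for x
  have max: "\<exists>y\<in>prob_simplex. P x y = F x" for x
    using max_payoff_attained[of "\<lambda>_. x" M S] by (simp add: P_def F_def)
  have cont: "continuous_on prob_simplex (P x)" for x
    unfolding P_def sum_payoff_right by (intro continuous_intros)
  have le: "P x y \<le> F x" if "y \<in> prob_simplex" for x y
    unfolding F_def using that
    by (intro cSUP_upper bounded_imp_bdd_above compact_imp_bounded
        compact_continuous_image cont compact_prob_simplex)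
  have contl: "continuous_on UNIV (\<lambda>x. P x y)" for y
    unfolding P_def payoff_def by (intro continuous_intros)
  have "\<exists>x\<in>prob_simplex. \<forall>z\<in>prob_simplex. F x \<le> F z"
  proof -
    let ?m = "INF x\<in>prob_simplex. F x"
    obtain y0 :: "real ^ 'b" where y0: "y0 \<in> prob_simplex" using prob_simplex_nonempty by blast
    have bdd: "bdd_below (F ` prob_simplex)"
    proof -
      have "bdd_below ((\<lambda>x. P x y0) ` prob_simplex)"
        by (intro bounded_imp_bdd_below compact_imp_bounded compact_continuous_image
            compact_prob_simplex continuous_on_subset[OF contl]) auto
      then obtain c where "\<And>x. x \<in> prob_simplex \<Longrightarrow> c \<le> P x y0"
        by (auto simp: bdd_below_def)
      then show ?thesis
        by (intro bdd_belowI2[of _ c]) (use le[OF y0] order_trans in blast)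
    qed
    have inf: "\<exists>z\<in>prob_simplex. F z < ?m + inverse (real (Suc n))" for n
      using cINF_less_iff[OF prob_simplex_nonempty bdd, of "?m + inverse (real (Suc n))"] by auto
    then obtain z where z: "\<And>n. z n \<in> prob_simplex"
      "\<And>n. F (z n) < ?m + inverse (real (Suc n))" by metis
    obtain l r where l: "l \<in> prob_simplex" and r: "strict_mono r" "(z \<circ> r) \<longlonglongrightarrow> l"
      using compact_imp_seq_compact[OF compact_prob_simplex] z(1) unfolding seq_compact_def
      by metis
    obtain y where y: "y \<in> prob_simplex" "P l y = F l" using max by blast
    have "(\<lambda>n. P ((z \<circ> r) n) y) \<longlonglongrightarrow> P l y"
      using contl r(2) by (auto simp: continuous_on_eq_continuous_at simp del: o_apply
          intro: isCont_tendsto_compose)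
    moreover have "(\<lambda>n. ?m + inverse (real (Suc (r n)))) \<longlonglongrightarrow> ?m + 0"
      using LIMSEQ_subseq_LIMSEQ[OF LIMSEQ_inverse_real_of_nat r(1)]
      by (intro tendsto_intros) (simp add: o_def)
    ultimately have "P l y \<le> ?m + 0"
    proof (rule LIMSEQ_le, intro exI allI impI)
      fix n show "P ((z \<circ> r) n) y \<le> ?m + inverse (real (Suc (r n)))"
        using le[OF y(1), of "z (r n)"] z(2)[of "r n"] by simp
    qed
    then have "F l \<le> F w" if "w \<in> prob_simplex" for w
      using cINF_lower[OF bdd that] y(2) by simp
    then show ?thesis using l by blast
  qed
  then obtain x where x: "x \<in> prob_simplex" "\<And>z. z \<in> prob_simplex \<Longrightarrow> F x \<le> F z" by blast
  then have "F x = (INF x\<in>prob_simplex. F x)"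
    by (intro cInf_eq_minimum[symmetric]) auto
  with x(1) show ?thesis unfolding F_def P_def by blast
qed

end

theory Submission imports Defs begin

text \<open>
  Let \<open>u\<close> and \<open>v\<close> be vectors with one entry \<open>1\<close> and all others \<open>-1\<close>. The adversary is oblivious:
  it plays matching pennies \<open>u v\<^sup>T\<close>, except that in the rounds \<open>3\<cdot>4\<^sup>k < t \<le> 4\<cdot>4\<^sup>k\<close> it plays
  \<open>1 v\<^sup>T\<close>, whose payoff does not depend on player 1. At the times \<open>3\<cdot>4\<^sup>k\<close> and \<open>4\<cdot>4\<^sup>k\<close> at least half
  of the rounds were matching pennies, so the cumulative game has value \<open>0\<close>. The first objective then
  makes the realized payoff \<open>o(T)\<close>, and the third makes \<open>\<bar>P T\<bar> = o(T)\<close>, where \<open>P T\<close> is the gain that a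
  fixed \<open>y\<close> with \<open>v \<bullet> y = 1\<close> would have had. But \<open>P\<close> grows by exactly \<open>4\<^sup>k\<close> between the two times.
\<close>

definition sign_vec :: "'d::finite \<Rightarrow> real ^ 'd" where
  "sign_vec k = (\<chi> i. if i = k then 1 else -1)"

definition outer :: "real ^ 'm::finite \<Rightarrow> real ^ 'n::finite \<Rightarrow> real ^ 'n ^ 'm" where
  "outer w v = (\<chi> i j. w $ i * v $ j)"

lemma payoff_outer: "payoff x (outer w v) y = (x \<bullet> w) * (y \<bullet> v)"
proof -
  have "outer w v *v y = (y \<bullet> v) *\<^sub>R w"
    by (vector outer_def matrix_vector_mult_def inner_vec_def sum_distrib_left mult_ac)
  then show ?thesis by (simp add: payoff_def mult_ac)
qed

lemma prob_simplex_sum: "x \<in> prob_simplex \<Longrightarrow> (\<Sum>i\<in>UNIV. x $ i) = 1"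
  by (auto simp: prob_simplex_def)

lemma inner_one_prob_simplex: "x \<in> prob_simplex \<Longrightarrow> x \<bullet> 1 = 1"
  using prob_simplex_sum[of x] by (simp add: inner_vec_def)

lemma axis_in_prob_simplex: "axis k 1 \<in> prob_simplex"
  by (simp add: prob_simplex_def axis_def if_distrib cong: if_cong)

lemma convex_axis_in_prob_simplex:
  fixes i j :: "'d::finite"
  assumes "0 \<le> l" "l \<le> 1"
  shows "l *\<^sub>R axis i 1 + (1 - l) *\<^sub>R axis j 1 \<in> prob_simplex"
proof -
  let ?x = "l *\<^sub>R axis i 1 + (1 - l) *\<^sub>R axis j 1 :: real ^ 'd"
  have nonneg: "0 \<le> ?x $ k" for k
    using assms by (simp add: axis_def)
  then have "(\<Sum>k\<in>UNIV. \<bar>?x $ k\<bar>) = (\<Sum>k\<in>UNIV. ?x $ k)"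
    by simp
  also have "\<dots> = l * (\<Sum>k\<in>UNIV. axis i 1 $ k) + (1 - l) * (\<Sum>k\<in>UNIV. axis j 1 $ k)"
    by (simp add: sum.distrib sum_distrib_left)
  also have "\<dots> = 1"
    by (simp add: prob_simplex_sum axis_in_prob_simplex)
  finally show ?thesis using nonneg by (simp add: prob_simplex_def)
qed

lemma inner_sign_vec_abs_le:
  assumes "x \<in> prob_simplex"
  shows "\<bar>x \<bullet> sign_vec k\<bar> \<le> 1"
proof -
  have "\<bar>x \<bullet> sign_vec k\<bar> \<le> (\<Sum>i\<in>UNIV. \<bar>x $ i * sign_vec k $ i\<bar>)"
    unfolding inner_vec_def by (simp add: sum_abs)
  also have "\<dots> = (\<Sum>i\<in>UNIV. \<bar>x $ i\<bar>)"
    by (intro sum.cong) (auto simp: sign_vec_def)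
  also have "\<dots> = 1" using assms unfolding prob_simplex_def by blast
  finally show ?thesis .
qed

lemma exists_other_element:
  assumes "CARD('d::finite) \<ge> 2"
  shows "\<exists>l. l \<noteq> (k :: 'd)"
  using assms by (metis (full_types) UNIV_I card_le_Suc0_iff_eq finite not_less_eq_eq
      numeral_2_eq_2)

text \<open>A pure strategy attains the maximum: on \<open>axis k 1\<close> the inner product is 1,
  on any other axis it is -1, so player 2 can match the sign of \<open>c\<close>.\<close>

lemma SUP_simplex_sign_vec:
  fixes k :: "'d::finite"
  assumes "CARD('d) \<ge> 2"
  shows "(SUP y\<in>prob_simplex. c * (y \<bullet> sign_vec k)) = \<bar>c\<bar>"
proof (rule cSup_eq_maximum)
  obtain l where "l \<noteq> k"
    using exists_other_element[OF assms] by blast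
  then have "\<bar>c\<bar> = c * (axis (if c \<ge> 0 then k else l) 1 \<bullet> sign_vec k)"
    by (simp add: inner_axis' sign_vec_def)
  then show "\<bar>c\<bar> \<in> (\<lambda>y. c * (y \<bullet> sign_vec k)) ` prob_simplex"
    using axis_in_prob_simplex by blast
next
  fix z assume "z \<in> (\<lambda>y. c * (y \<bullet> sign_vec k)) ` prob_simplex"
  then obtain y where y: "y \<in> prob_simplex" "z = c * (y \<bullet> sign_vec k)" by blast
  have "\<bar>z\<bar> \<le> \<bar>c\<bar> * 1"
    unfolding y(2) abs_mult by (intro mult_left_mono inner_sign_vec_abs_le y(1)) simp
  then show "z \<le> \<bar>c\<bar>" by simp
qed

text \<open>On \<open>axis k 1\<close> the inner product is \<open>a + b\<close>, on any other axis
  it is \<open>b - a\<close>. As \<open>b \<le> a\<close>, these have opposite signs or vanish, so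
  some mixture of two axes gives 0.\<close>

lemma INF_abs_simplex_sign_vec:
  fixes k :: "'d::finite"
  assumes card: "CARD('d) \<ge> 2" and ab: "0 \<le> b" "b \<le> a"
  shows "(INF x\<in>prob_simplex. \<bar>x \<bullet> (a *\<^sub>R sign_vec k + b *\<^sub>R 1)\<bar>) = 0"
proof (rule cInf_eq_minimum)
  obtain j where "j \<noteq> k"
    using exists_other_element[OF card] by blast
  \<comment> \<open>The root of \<open>l * (a + b) + (1 - l) * (b - a)\<close>. If
    \<open>a = 0\<close>, then \<open>b = 0\<close> too, and division by zero gives the harmless
    value \<open>l = 0\<close>.\<close>
  define l where "l = (a - b) / (2 * a)"
  have l: "0 \<le> l" "l \<le> 1" "2 * (a * l) = a - b"
    using ab by (cases "a = 0"; simp add: l_def field_simps)+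
  let ?x = "l *\<^sub>R axis k 1 + (1 - l) *\<^sub>R axis j 1 :: real ^ 'd"
  have "?x \<bullet> (a *\<^sub>R sign_vec k + b *\<^sub>R 1) = l * (a + b) + (1 - l) * (b - a)"
    using \<open>j \<noteq> k\<close> by (simp add: inner_add_left inner_axis' sign_vec_def)
  also have "\<dots> = 0" using l(3) by (simp add: algebra_simps)
  finally show "0 \<in> (\<lambda>x. \<bar>x \<bullet> (a *\<^sub>R sign_vec k + b *\<^sub>R 1)\<bar>) ` prob_simplex"
    using convex_axis_in_prob_simplex[OF l(1,2)]
    by (intro image_eqI[of _ _ ?x]) auto
qed auto

text \<open>Each block makes up a quarter of all rounds up to its end, so a drift of 1 per round
  within one block is not o(T).\<close>

definition biased_rounds :: "nat set" where
  "biased_rounds = (\<Union>k. {3 * 4 ^ k<..4 * 4 ^ k})"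

lemma biased_rounds_disjoint: "{4 ^ k<..3 * 4 ^ k} \<inter> biased_rounds = {}"
proof -
  have False if "4 ^ k < t" "t \<le> 3 * 4 ^ k" "3 * 4 ^ j < t" "t \<le> 4 * 4 ^ j" for t j :: nat
  proof -
    \<comment> \<open>A common round would lie before the end of block \<open>j\<close>, forcing
      \<open>k \<le> j\<close>, and after its start, forcing \<open>j < k\<close>.\<close>
    have "(4::nat) ^ k < 4 ^ Suc j" using that by simp
    then have "k < Suc j" by (subst (asm) power_strict_increasing_iff) auto
    moreover have "(4::nat) ^ j < 4 ^ k" using that by linarith
    then have "j < k" by (subst (asm) power_strict_increasing_iff) auto
    ultimately show False by simp
  qed
  then show ?thesis by (fastforce simp: biased_rounds_def)
qed

text \<open>The unbiased stretch from \<open>4 ^ k\<close> to \<open>3 * 4 ^ k\<close> alone has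
  \<open>2 * 4 ^ k\<close> rounds, at least half of \<open>T\<close>.\<close>

lemma card_biased_le:
  assumes "3 * 4 ^ k \<le> T" "T \<le> 4 * 4 ^ k"
  shows "card ({1..T} \<inter> biased_rounds) \<le> card ({1..T} - biased_rounds)"
proof -
  have "{4 ^ k<..3 * 4 ^ k} \<subseteq> {1..T} - biased_rounds"
    using biased_rounds_disjoint[of k] assms(1) by auto
  then have "card {4 ^ k<..3 * 4 ^ k :: nat} \<le> card ({1..T} - biased_rounds)"
    by (intro card_mono) auto
  moreover have "card ({1..T} \<inter> biased_rounds) + card ({1..T} - biased_rounds) = T"
    by (subst card_Un_disjoint[symmetric]) (auto simp: Int_Diff_Un)
  ultimately show ?thesis using assms(2) by simp
qed

theorem theorem1:
  fixes alg :: "('m::finite, 'n::finite) algorithm"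
  assumes "CARD('m) \<ge> 2" and "CARD('n) \<ge> 2"
    and "\<And>h. alg h \<in> prob_simplex \<times> prob_simplex"
  shows "\<exists>A :: nat \<Rightarrow> real ^ 'n ^ 'm.
    (\<forall>t\<ge>1. \<forall>i j. A t $ i $ j \<in> {-1..1}) \<and>
    \<not> ((\<lambda>T. \<bar>(\<Sum>t=1..T. payoff (strategy1 alg A t) (A t) (strategy2 alg A t))
              - (INF x\<in>prob_simplex. SUP y\<in>prob_simplex. \<Sum>t=1..T. payoff x (A t) y)\<bar>)
          \<in> o(\<lambda>T. real T) \<and>
       (\<lambda>T. (\<Sum>t=1..T. payoff (strategy1 alg A t) (A t) (strategy2 alg A t))
             - (INF x\<in>prob_simplex. \<Sum>t=1..T. payoff x (A t) (strategy2 alg A t)))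
          \<in> o(\<lambda>T. real T) \<and>
       (\<lambda>T. (SUP y\<in>prob_simplex. \<Sum>t=1..T. payoff (strategy1 alg A t) (A t) y)
             - (\<Sum>t=1..T. payoff (strategy1 alg A t) (A t) (strategy2 alg A t)))
          \<in> o(\<lambda>T. real T))"
proof -
  obtain k :: 'm and l :: 'n where True by simp
  define w :: "nat \<Rightarrow> real ^ 'm" where "w t = (if t \<in> biased_rounds then 1 else sign_vec k)" for t
  define A :: "nat \<Rightarrow> real ^ 'n ^ 'm" where "A t = outer (w t) (sign_vec l)" for t
  define x where "x t = strategy1 alg A t" for t
  define S where "S T = (\<Sum>t=1..T. payoff (x t) (A t) (strategy2 alg A t))" for T
  define P where "P T = (\<Sum>t=1..T. x t \<bullet> w t)" for T
  have x: "x t \<in> prob_simplex" for t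
    using assms(3)[of "map A [1..<t]"] by (auto simp: x_def strategy1_def mem_Times_iff)
  \<comment> \<open>All matrices share the factor \<open>sign_vec l\<close>, so the total payoff is
    a scalar times \<open>y \<bullet> sign_vec l\<close>. A constant \<open>z\<close> serves for the
    game value, \<open>z = x\<close> for the third objective.\<close>
  have best_y: "(SUP y\<in>prob_simplex. \<Sum>t=1..T. payoff (z t) (A t) y) = \<bar>\<Sum>t=1..T. z t \<bullet> w t\<bar>"
    for z T
    using SUP_simplex_sign_vec[OF assms(2), of "\<Sum>t=1..T. z t \<bullet> w t" l]
    by (simp add: A_def payoff_outer sum_distrib_right)
  have sum_w: "(\<Sum>t=1..T. w t) = real (card ({1..T} - biased_rounds)) *\<^sub>R sign_vec k
      + real (card ({1..T} \<inter> biased_rounds)) *\<^sub>R 1" for T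
  proof -
    have "(\<Sum>t=1..T. w t) = (\<Sum>t\<in>{1..T} - biased_rounds. w t) + (\<Sum>t\<in>{1..T} \<inter> biased_rounds. w t)"
      by (subst sum.Int_Diff[of _ _ biased_rounds]) (simp_all add: add.commute)
    also have "(\<Sum>t\<in>{1..T} - biased_rounds. w t) = (\<Sum>t\<in>{1..T} - biased_rounds. sign_vec k)"
      by (intro sum.cong) (auto simp: w_def)
    also have "(\<Sum>t\<in>{1..T} \<inter> biased_rounds. w t) = (\<Sum>t\<in>{1..T} \<inter> biased_rounds. 1)"
      by (intro sum.cong) (auto simp: w_def)
    finally show ?thesis by (simp only: sum_constant_scaleR)
  qed
  have value_zero: "(INF z\<in>prob_simplex. SUP y\<in>prob_simplex. \<Sum>t=1..T. payoff z (A t) y) = 0"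
    if "3 * 4 ^ n \<le> T" "T \<le> 4 * 4 ^ n" for T n
    unfolding best_y inner_sum_right[symmetric] sum_w
    using INF_abs_simplex_sign_vec[OF assms(1)] card_biased_le[OF that] by simp
  \<comment> \<open>In these rounds \<open>w t = 1\<close>, so each \<open>x t\<close>, however
    chosen, contributes exactly 1.\<close>
  have growth: "P (4 * 4 ^ n) - P (3 * 4 ^ n) = 4 ^ n" for n
  proof -
    have "P (4 * 4 ^ n) = P (3 * 4 ^ n) + (\<Sum>t\<in>{3 * 4 ^ n<..4 * 4 ^ n}. x t \<bullet> w t)"
      unfolding P_def by (subst sum.union_disjoint[symmetric]) (auto intro!: sum.cong)
    also have "(\<Sum>t\<in>{3 * 4 ^ n<..4 * 4 ^ n}. x t \<bullet> w t) = (\<Sum>t\<in>{3 * 4 ^ n<..4 * 4 ^ n::nat}. 1)"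
      by (intro sum.cong)
        (auto simp: w_def biased_rounds_def intro!: inner_one_prob_simplex x)
    finally show ?thesis by simp
  qed
  have bounds: "A t $ i $ j \<in> {-1..1}" for t i j
    by (simp add: A_def outer_def w_def sign_vec_def)
  have False
    if obj1: "(\<lambda>T. \<bar>S T - (INF z\<in>prob_simplex. SUP y\<in>prob_simplex. \<Sum>t=1..T. payoff z (A t) y)\<bar>)
        \<in> o(\<lambda>T. real T)" (is "?f \<in> _")
      and obj3: "(\<lambda>T. (SUP y\<in>prob_simplex. \<Sum>t=1..T. payoff (x t) (A t) y) - S T) \<in> o(\<lambda>T. real T)"
  proof -
    have obj3': "(\<lambda>T. \<bar>P T\<bar> - S T) \<in> o(\<lambda>T. real T)"
      using obj3 unfolding best_y P_def .
    \<comment> \<open>Two errors of \<open>T / 15\<close> give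
      \<open>\<bar>P T\<bar> \<le> 2 * T / 15\<close>. Over the two times this allows a change of at
      most (6 + 8)/15 of \<open>4 ^ N\<close>, just below the true growth.\<close>
    have "\<forall>\<^sub>F T in sequentially. \<bar>?f T\<bar> \<le> T / 15 \<and> \<bar>\<bar>P T\<bar> - S T\<bar> \<le> T / 15"
      by (rule eventually_mono[OF eventually_conj[OF landau_o.smallD[OF obj1, of "1/15"]
              landau_o.smallD[OF obj3', of "1/15"]]]) simp_all
    then obtain N where N: "\<And>T. T \<ge> N \<Longrightarrow> \<bar>?f T\<bar> \<le> T / 15 \<and> \<bar>\<bar>P T\<bar> - S T\<bar> \<le> T / 15"
      unfolding eventually_sequentially by blast
    have small: "\<bar>P T\<bar> \<le> 2 * T / 15" if "3 * 4 ^ N \<le> T" "T \<le> 4 * 4 ^ N" for T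
    proof -
      \<comment> \<open>\<open>N\<close> is both the threshold and the block index; this puts both
        times past the threshold.\<close>
      have "N < 4 ^ N" by (rule less_exp[THEN less_le_trans]) (simp add: power_mono)
      then have "T \<ge> N" using that by linarith
      then show ?thesis using N[of T] unfolding value_zero[OF that] by linarith
    qed
    have "\<bar>P (3 * 4 ^ N)\<bar> \<le> 6 * 4 ^ N / 15" "\<bar>P (4 * 4 ^ N)\<bar> \<le> 8 * 4 ^ N / 15"
      using small[of "3 * 4 ^ N"] small[of "4 * 4 ^ N"] by simp_all
    moreover have "(0::real) < 4 ^ N" by simp
    ultimately show False using growth[of N] by linarith
  qed
  then show ?thesis
    using bounds unfolding S_def x_def by (intro exI[of _ A]) blast
qed

end
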